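(* Let $(\alpha_1,\alpha_2)$ be one of $(c,r)$, $(c,rc)$, $(rc,r)$, $(rc,rc)$. Any $n\times n$ strictly upper triangular matrix of an $\alpha_1$-$\alpha_2$-formation is CN-realizable. That is: let $1\le k<l\le m\le n$, let $M_1$ be an $n\times n$ matrix of an $\alpha_1(k,l)$-formation, let $M_2$ be an $n\times n$ matrix of an $\alpha_2(l-1,m)$-formation, and let $M_3$ be the $n\times n$ matrix with $M_3(l-1,l)=2$ and all other entries $0$. Then $M=M_1+M_2-M_3$ is CN-realizable.
   Context: Formations (all matrices $n\times n$, strictly upper triangular). - $r(k,J)$-formation, $1\le k<J\le n$: the $(k,j)$ entry is $2$ for $k+1\le j\le J$ and all other entries are $0$. - $c(I,l)$-formation, $1\le I<l\le n$: the $(i,l)$ entry is $2$ for $I\le i\le l-1$ and all other entries are $0$. - $rc(k,l)$-formation: a matrix of the form $A_1+A_2+A_3$, where for some integers $I,J$ with $k<J<l$, $k<I<l$, $I-J\le 1$, $A_1$ has the $r(k,J)$-formation, $A_2$ has the $c(I,l)$-formation, and $A_3$ has $(k,l)$ entry $2$ and all other entries $0$ (this requires $l\ge k+2$). Braid projections. An $n$-braid projection $B$ consists of $n$ strands in the plane, each running monotonically downward from one of $n$ points on an upper horizontal bar to one of $n$ points on a lower horizontal bar, meeting each other only in finitely many transverse double points (crossings), with no over/under information. The strands are named $s_1,\dots,s_n$ from left to right at the top. Combinatorially, $B$ is encoded by a finite word with letters in $\{1,\dots,n-1\}$: reading from top to bottom, the letter $k$ means that the two strands currently in positions $k$ and $k+1$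 cross once and exchange positions (no reduction is assumed). The CN matrix $N(B)$ is the symmetric zero-diagonal $n\times n$ matrix whose $(i,j)$ entry ($i\neq j$) is the number of crossings between $s_i$ and $s_j$. CN matrices are represented by strictly upper triangular matrices: a strictly upper triangular $n\times n$ matrix $M$ is CN-realizable if there is an $n$-braid projection $B$ with $M(i,j)=N(B)(i,j)$ for all $1\le i<j\le n$. *)

theory Defs
  imports "Jordan_Normal_Form.Matrix"
begin

text \<open>Matrices are 0-indexed in the library. All row, column, strand and position indices below
  run from 1 to n; the following two functions are the only places where the shift happens.\<close>

definition mat1 :: "nat \<Rightarrow> (nat \<Rightarrow> nat \<Rightarrow> int) \<Rightarrow> int mat" where
  "mat1 n f = mat n n (\<lambda>(i, j). f (i + 1) (j + 1))"

definition entry :: "int mat \<Rightarrow> nat \<Rightarrow> nat \<Rightarrow> int" where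
  "entry A i j = A $$ (i - 1, j - 1)"

lemma mat1_carrier [simp]: "mat1 n f \<in> carrier_mat n n"
  by (simp add: mat1_def)

lemma entry_mat1 [simp]:
  "1 \<le> i \<Longrightarrow> i \<le> n \<Longrightarrow> 1 \<le> j \<Longrightarrow> j \<le> n \<Longrightarrow> entry (mat1 n f) i j = f i j"
  by (simp add: mat1_def entry_def)

definition strictly_upper_triangular :: "nat \<Rightarrow> int mat \<Rightarrow> bool" where
  "strictly_upper_triangular n A \<longleftrightarrow>
     A \<in> carrier_mat n n \<and> (\<forall>i j. 1 \<le> j \<and> j \<le> i \<and> i \<le> n \<longrightarrow> entry A i j = 0)"

definition two_at :: "nat \<Rightarrow> nat \<Rightarrow> nat \<Rightarrow> int mat" where
  "two_at n k l = mat1 n (\<lambda>i j. if i = k \<and> j = l then 2 else 0)"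

definition r_formation :: "nat \<Rightarrow> nat \<Rightarrow> nat \<Rightarrow> int mat \<Rightarrow> bool" where
  "r_formation n k J A \<longleftrightarrow> 1 \<le> k \<and> k < J \<and> J \<le> n \<and>
     A = mat1 n (\<lambda>i j. if i = k \<and> k + 1 \<le> j \<and> j \<le> J then 2 else 0)"

definition c_formation :: "nat \<Rightarrow> nat \<Rightarrow> nat \<Rightarrow> int mat \<Rightarrow> bool" where
  "c_formation n I l A \<longleftrightarrow> 1 \<le> I \<and> I < l \<and> l \<le> n \<and>
     A = mat1 n (\<lambda>i j. if I \<le> i \<and> i \<le> l - 1 \<and> j = l then 2 else 0)"

definition rc_formation :: "nat \<Rightarrow> nat \<Rightarrow> nat \<Rightarrow> int mat \<Rightarrow> bool" where
  "rc_formation n k l A \<longleftrightarrow>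
     (\<exists>I J A1 A2. k < J \<and> J < l \<and> k < I \<and> I < l \<and> int I - int J \<le> 1 \<and>
        r_formation n k J A1 \<and> c_formation n I l A2 \<and> A = A1 + A2 + two_at n k l)"

text \<open>A braid projection on n strands is a word, read from top to bottom; the letter k exchanges
  the strands in positions k and k + 1.\<close>

definition braid_projection :: "nat \<Rightarrow> nat list \<Rightarrow> bool" where
  "braid_projection n w \<longleftrightarrow> set w \<subseteq> {1..<n}"

text \<open>The argument s maps each position to the strand currently in it.\<close>

fun crossings :: "(nat \<Rightarrow> nat) \<Rightarrow> nat list \<Rightarrow> nat \<Rightarrow> nat \<Rightarrow> nat" where
  "crossings s [] i j = 0"
| "crossings s (k # w) i j =
     (if {s k, s (k + 1)} = {i, j} then 1 else 0)
     + crossings (s(k := s (k + 1), k + 1 := s k)) w i j"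

definition CN_matrix :: "nat \<Rightarrow> nat list \<Rightarrow> int mat" where
  "CN_matrix n w = mat1 n (\<lambda>i j. if i = j then 0 else int (crossings id w i j))"

definition CN_realizable :: "nat \<Rightarrow> int mat \<Rightarrow> bool" where
  "CN_realizable n M \<longleftrightarrow> strictly_upper_triangular n M \<and>
     (\<exists>w. braid_projection n w \<and>
        (\<forall>i j. 1 \<le> i \<and> i < j \<and> j \<le> n \<longrightarrow> entry M i j = entry (CN_matrix n w) i j))"

end

theory Submission
  imports Defs "HOL-Combinatorics.Transposition"
begin

text \<open>Put p = l - 1. Cross strands p and p + 1 once, so that strand p + 1 lies to the left of
  strand p; let strand p + 1 realize the first formation by a palindromic word in which it moves
  left, then let strand p realize the second formation by a palindromic word in which it moves
  right, and finally cross the two strands back. Palindromes u @ rev u fix all strands and produce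
  every crossing of u twice.\<close>

section \<open>Positions of strands and crossings of a pair\<close>

text \<open>This sends an initial position to the final one, the direction opposite to the map from
  positions to strands in \<open>crossings\<close>.\<close>

fun track :: "nat list \<Rightarrow> nat \<Rightarrow> nat" where
  "track [] x = x"
| "track (k # w) x = track w (transpose k (Suc k) x)"

lemma track_append [simp]: "track (u @ v) x = track v (track u x)"
  by (induction u arbitrary: x) auto

text \<open>The first and last letters of the word are the same transposition and cancel; induction
  peels them off.\<close>

lemma track_conj: "(\<And>x. track v x = x) \<Longrightarrow> track (u @ v @ rev u) x = x"
  by (induction u arbitrary: x) auto

lemma track_rev [simp]: "track (rev u) (track u x) = x"
  using track_conj[of "[]" u x] by simp

text \<open>Relabelling strands commutes with exchanging positions, and injectivity keeps the tests
  on unordered pairs equivalent.\<close>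

lemma crossings_comp:
  "inj s \<Longrightarrow> crossings (s \<circ> t) w (s x) (s y) = crossings t w x y"
proof (induction w arbitrary: t)
  case (Cons k w)
  have "{s (t k), s (t (k + 1))} = {s x, s y} \<longleftrightarrow> {t k, t (k + 1)} = {x, y}"
    using Cons.prems by (auto simp: doubleton_eq_iff dest: injD)
  moreover have upd: "(s \<circ> t)(k := (s \<circ> t) (k + 1), k + 1 := (s \<circ> t) k)
      = s \<circ> (t(k := t (k + 1), k + 1 := t k))"
    by auto
  ultimately show ?case
    unfolding crossings.simps upd Cons.IH[OF Cons.prems] by (simp only: o_apply)
qed simp

text \<open>A separate constant lets simplification use a recursion that moves just the two
  positions, in place of the one that updates the whole arrangement.\<close>

definition pair_crossings :: "nat list \<Rightarrow> nat \<Rightarrow> nat \<Rightarrow> nat" where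
  "pair_crossings w i j = crossings id w i j"

lemma pair_crossings_Nil [simp]: "pair_crossings [] x y = 0"
  by (simp add: pair_crossings_def)

text \<open>After the letter \<open>k\<close> the arrangement is a transposition; as it is an
  involution, \<open>crossings_comp\<close> resets it to \<open>id\<close> and moves it onto the
  pair.\<close>

lemma pair_crossings_Cons [simp]:
  "pair_crossings (k # w) x y =
     (if {k, Suc k} = {x, y} then 1 else 0)
     + pair_crossings w (transpose k (Suc k) x) (transpose k (Suc k) y)"
proof -
  let ?\<tau> = "transpose k (Suc k)"
  have "id(k := Suc k, Suc k := k) = ?\<tau> \<circ> id"
    by (auto simp: transpose_def)
  moreover have "crossings (?\<tau> \<circ> id) w x y = crossings id w (?\<tau> x) (?\<tau> y)"
    using crossings_comp[of ?\<tau> id w "?\<tau> x" "?\<tau> y"] by simp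
  ultimately show ?thesis
    unfolding pair_crossings_def crossings.simps by (simp only: id_apply Suc_eq_plus1)
qed

lemma pair_crossings_append:
  "pair_crossings (u @ v) x y = pair_crossings u x y + pair_crossings v (track u x) (track u y)"
  by (induction u arbitrary: x y) auto

text \<open>Since \<open>v\<close> returns every strand to its position, the mirrored letters of
  \<open>rev u\<close> meet the same pairs as those of \<open>u\<close>.\<close>

lemma pair_crossings_conj:
  assumes "\<And>x. track v x = x"
  shows "pair_crossings (u @ v @ rev u) x y =
    2 * pair_crossings u x y + pair_crossings v (track u x) (track u y)"
proof (induction u arbitrary: x y)
  case (Cons k u)
  let ?\<tau> = "transpose k (Suc k)"
  have "{k, Suc k} = {?\<tau> x, ?\<tau> y} \<longleftrightarrow> {k, Suc k} = {x, y}"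
    by (auto simp: doubleton_eq_iff transpose_def split: if_splits)
  moreover have "pair_crossings (k # (u @ v @ rev u) @ [k]) x y
      = (if {k, Suc k} = {x, y} then 1 else 0) + pair_crossings (u @ v @ rev u) (?\<tau> x) (?\<tau> y)
        + (if {k, Suc k} = {?\<tau> x, ?\<tau> y} then 1 else 0)"
    using pair_crossings_append[of "u @ v @ rev u" "[k]" "?\<tau> x" "?\<tau> y"]
      track_conj[OF assms, of u] by (simp del: track_append)
  ultimately show ?case
    by (simp add: Cons.IH)
qed simp

lemma pair_crossings_palindrome:
  "pair_crossings (u @ rev u) x y = 2 * pair_crossings u x y"
  using pair_crossings_conj[of "[]" u x y] by simp

section \<open>Runs in which one strand passes a block\<close>

lemma track_upt:
  "p \<le> q \<Longrightarrow> track [p..<q] x = (if x = p then q else if p < x \<and> x \<le> q then x - 1 else x)"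
  by (induction q rule: dec_induct) (auto simp: transpose_def)

text \<open>Reversal puts the new letter \<open>q\<close> in front, so the induction hypothesis is
  needed at the transposed position, hence for arbitrary \<open>x\<close>.\<close>

lemma track_rev_upt:
  "p \<le> q \<Longrightarrow> track (rev [p..<q]) x = (if x = q then p else if p \<le> x \<and> x < q then x + 1 else x)"
  by (induction q arbitrary: x rule: dec_induct) (auto simp: transpose_def)

text \<open>Every letter of the run involves the strand that starts in \<open>p\<close>, which meets
  each strand of the block once.\<close>

lemma pair_crossings_upt:
  assumes "p \<le> q"
  shows "pair_crossings [p..<q] x y = of_bool (x = p \<and> p < y \<and> y \<le> q \<or> y = p \<and> p < x \<and> x \<le> q)"
  using assms
proof (induction q rule: dec_induct)
  case (step q)
  then show ?case
    by (auto simp: pair_crossings_append track_upt doubleton_eq_iff)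
qed simp

lemma pair_crossings_rev_upt:
  assumes "p \<le> q"
  shows "pair_crossings (rev [p..<q]) x y = of_bool (x = q \<and> p \<le> y \<and> y < q \<or> y = q \<and> p \<le> x \<and> x < q)"
  using assms
proof (induction q arbitrary: x y rule: dec_induct)
  case (step q)
  then show ?case
    by (auto simp: doubleton_eq_iff transpose_def)
qed simp

section \<open>Realizing each formation after the swap\<close>

text \<open>The bounds \<open>J < l\<close> and \<open>k < I\<close> make the row, the column and
  the corner disjoint, so their sum is a single indicator with value 2.\<close>

lemma rc_formationE:
  assumes "rc_formation n k l A"
  obtains I J where "1 \<le> k" "k < J" "J < l" "k < I" "I < l" "I \<le> Suc J" "l \<le> n"
    and "A = mat1 n (\<lambda>i j. if i = k \<and> (k < j \<and> j \<le> J \<or> j = l) \<or> j = l \<and> I \<le> i \<and> i < l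
          then 2 else 0)"
proof -
  obtain I J A1 A2 where IJ: "k < J" "J < l" "k < I" "I < l" "int I - int J \<le> 1"
    and r: "r_formation n k J A1" and c: "c_formation n I l A2" and A: "A = A1 + A2 + two_at n k l"
    using assms unfolding rc_formation_def by blast
  have "A = mat1 n (\<lambda>i j. if i = k \<and> (k < j \<and> j \<le> J \<or> j = l) \<or> j = l \<and> I \<le> i \<and> i < l
          then 2 else 0)"
    using r c A IJ
    by (intro eq_matI) (auto simp: r_formation_def c_formation_def two_at_def mat1_def)
  moreover have "I \<le> Suc J" "1 \<le> k" "l \<le> n"
    using IJ r c by (auto simp: r_formation_def c_formation_def)
  ultimately show ?thesis
    using that[of J I] IJ by blast
qed

text \<open>The word u starts after strands p and p + 1 have exchanged positions, so strand i is then in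
  position transpose p (p + 1) i; the separate summand accounts for the two exchanges of p and p + 1
  around u.\<close>

definition realizable_after_swap :: "nat \<Rightarrow> nat \<Rightarrow> int mat \<Rightarrow> bool" where
  "realizable_after_swap n p M \<longleftrightarrow> (\<exists>u. set u \<subseteq> {1..<n} \<and>
     M = mat1 n (\<lambda>i j. if i < j then
        2 * int (pair_crossings u (transpose p (Suc p) i) (transpose p (Suc p) j))
        + (if i = p \<and> j = Suc p then 2 else 0) else 0))"

text \<open>Strand \<open>Suc p\<close>, now in position \<open>p\<close>, runs left to
  \<open>k\<close>; its entry with strand \<open>p\<close> comes from the swap.\<close>

lemma c_formation_realizable_after_swap:
  assumes "c_formation n k (Suc p) M"
  shows "realizable_after_swap n p M"
proof -
  have "set (rev [k..<p]) \<subseteq> {1..<n}"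
    using assms by (auto simp: c_formation_def)
  moreover have "M = mat1 n (\<lambda>i j. if i < j then
        2 * int (pair_crossings (rev [k..<p]) (transpose p (Suc p) i) (transpose p (Suc p) j))
        + (if i = p \<and> j = Suc p then 2 else 0) else 0)"
    using assms unfolding c_formation_def
    by (auto simp: pair_crossings_rev_upt transpose_def intro!: arg_cong[where f = "mat1 n"] ext)
  ultimately show ?thesis
    unfolding realizable_after_swap_def by blast
qed

text \<open>Strand \<open>p\<close>, now in position \<open>Suc p\<close>, runs right to
  \<open>m\<close>.\<close>

lemma r_formation_realizable_after_swap:
  assumes "r_formation n p m M"
  shows "realizable_after_swap n p M"
proof -
  have "set [Suc p..<m] \<subseteq> {1..<n}"
    using assms by (auto simp: r_formation_def)
  moreover have "M = mat1 n (\<lambda>i j. if i < j then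
        2 * int (pair_crossings [Suc p..<m] (transpose p (Suc p) i) (transpose p (Suc p) j))
        + (if i = p \<and> j = Suc p then 2 else 0) else 0)"
    using assms unfolding r_formation_def
    by (auto simp: pair_crossings_upt transpose_def intro!: arg_cong[where f = "mat1 n"] ext)
  ultimately show ?thesis
    unfolding realizable_after_swap_def by blast
qed

lemma rc_formation_realizable_after_swap_left:
  assumes "rc_formation n k (Suc p) M"
  shows "realizable_after_swap n p M"
proof -
  obtain I J where IJ: "1 \<le> k" "k < J" "J < Suc p" "k < I" "I < Suc p" "I \<le> Suc J" "Suc p \<le> n"
    and M: "M = mat1 n (\<lambda>i j. if i = k \<and> (k < j \<and> j \<le> J \<or> j = Suc p) \<or>
        j = Suc p \<and> I \<le> i \<and> i < Suc p then 2 else 0)"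
    using assms by (rule rc_formationE)
  \<comment> \<open>Strand k stops just before strand I, strand p + 1 comes left past strand I, and then strand k
    crosses strand p + 1 and goes on to strand J. For J = p it thereby crosses strand p, which waits
    in position p + 1.\<close>
  define u where "u = [k..<I - 1] @ rev [I..<p] @ [I - 1..<Suc J]"
  have "set u \<subseteq> {1..<n}"
    unfolding u_def using IJ by auto
  have le: "k \<le> I - 1" "I \<le> p" "I - 1 \<le> Suc J"
    using IJ by auto
  have pos1: "track [k..<I - 1] (transpose p (Suc p) i) =
      (if i = k then I - 1 else if k < i \<and> i < I \<and> i < p then i - 1
       else if i = p then Suc p else if i = Suc p then p else i)" for i
    unfolding track_upt[OF le(1)] transpose_def using IJ by auto
  have pos2: "track (rev [I..<p]) (track [k..<I - 1] (transpose p (Suc p) i)) =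
      (if i = k then I - 1 else if k < i \<and> i < I \<and> i < p then i - 1
       else if I \<le> i \<and> i \<le> p then i + 1 else if i = Suc p then I else i)" for i
    unfolding track_rev_upt[OF le(2)] pos1 using IJ by auto
  \<comment> \<open>The \<open>end\<close> and \<open>range\<close> facts translate the conditions
    of the run lemmas from positions back to strand names: the moving strand and the block it
    passes.\<close>
  have end1: "transpose p (Suc p) i = k \<longleftrightarrow> i = k" for i
    unfolding transpose_def using IJ by auto
  have range1: "k < transpose p (Suc p) i \<and> transpose p (Suc p) i \<le> I - 1 \<longleftrightarrow> k < i \<and> i < I" for i
    unfolding transpose_def using IJ by auto
  have cross1: "pair_crossings [k..<I - 1] (transpose p (Suc p) i) (transpose p (Suc p) j)
      = of_bool (i = k \<and> j < I)" if "i < j" for i j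
    unfolding pair_crossings_upt[OF le(1)] end1 range1 using IJ that by (auto simp: of_bool_def)
  have end2: "track [k..<I - 1] (transpose p (Suc p) i) = p \<longleftrightarrow> i = Suc p" for i
    unfolding pos1 using IJ by auto
  have range2: "I \<le> track [k..<I - 1] (transpose p (Suc p) i) \<and>
      track [k..<I - 1] (transpose p (Suc p) i) < p \<longleftrightarrow> I \<le> i \<and> i < p" for i
    unfolding pos1 using IJ by auto
  have cross2: "pair_crossings (rev [I..<p]) (track [k..<I - 1] (transpose p (Suc p) i))
        (track [k..<I - 1] (transpose p (Suc p) j))
      = of_bool (I \<le> i \<and> i < p \<and> j = Suc p)" if "i < j" for i j
    unfolding pair_crossings_rev_upt[OF le(2)] end2 range2 using IJ that by (auto simp: of_bool_def)
  have end3: "track (rev [I..<p]) (track [k..<I - 1] (transpose p (Suc p) i)) = I - 1 \<longleftrightarrow> i = k" for i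
    unfolding pos2 using IJ by auto
  \<comment> \<open>Strand \<open>Suc p\<close> has taken position \<open>I\<close>, so strands
    \<open>I\<close> to \<open>J\<close> stand one place further right, ending at
    \<open>Suc J\<close>.\<close>
  have range3: "I - 1 < track (rev [I..<p]) (track [k..<I - 1] (transpose p (Suc p) i)) \<and>
      track (rev [I..<p]) (track [k..<I - 1] (transpose p (Suc p) i)) \<le> Suc J \<longleftrightarrow>
      i = Suc p \<or> I \<le> i \<and> i \<le> J" for i
    unfolding pos2 using IJ by auto
  have cross3: "pair_crossings [I - 1..<Suc J]
        (track (rev [I..<p]) (track [k..<I - 1] (transpose p (Suc p) i)))
        (track (rev [I..<p]) (track [k..<I - 1] (transpose p (Suc p) j)))
      = of_bool (i = k \<and> (j = Suc p \<or> I \<le> j \<and> j \<le> J))" if "i < j" for i j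
    unfolding pair_crossings_upt[OF le(3)] end3 range3 using IJ that by (auto simp: of_bool_def)
  \<comment> \<open>Here \<open>I \<le> Suc J\<close> joins the ranges \<open>j < I\<close> and
    \<open>I \<le> j \<le> J\<close> without a gap.\<close>
  have total: "pair_crossings u (transpose p (Suc p) i) (transpose p (Suc p) j)
      = of_bool (i = k \<and> (j \<le> J \<or> j = Suc p) \<or> j = Suc p \<and> I \<le> i \<and> i < p)"
    if "i < j" for i j
    unfolding u_def pair_crossings_append cross1[OF that] cross2[OF that] cross3[OF that]
    using IJ that by (auto simp: of_bool_def)
  have "M = mat1 n (\<lambda>i j. if i < j then
        2 * int (pair_crossings u (transpose p (Suc p) i) (transpose p (Suc p) j))
        + (if i = p \<and> j = Suc p then 2 else 0) else 0)"
    unfolding M using IJ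
    by (intro arg_cong[where f = "mat1 n"] ext) (auto simp: total)
  with \<open>set u \<subseteq> {1..<n}\<close> show ?thesis
    unfolding realizable_after_swap_def by blast
qed

lemma rc_formation_realizable_after_swap_right:
  assumes "rc_formation n p m M"
  shows "realizable_after_swap n p M"
proof -
  obtain I J where IJ: "1 \<le> p" "p < J" "J < m" "p < I" "I < m" "I \<le> Suc J" "m \<le> n"
    and M: "M = mat1 n (\<lambda>i j. if i = p \<and> (p < j \<and> j \<le> J \<or> j = m) \<or>
        j = m \<and> I \<le> i \<and> i < m then 2 else 0)"
    using assms by (rule rc_formationE)
  \<comment> \<open>Strand p stops just after strand J, strand m comes left past strand J + 1, and then strand m
    crosses strand p and goes on to strand I. For I = p + 1 it thereby crosses strand p + 1, which
    waits in position p.\<close>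
  define u where "u = [Suc p..<J] @ rev [Suc J..<m] @ rev [I - 1..<Suc J]"
  have "set u \<subseteq> {1..<n}"
    unfolding u_def using IJ by auto
  have le: "Suc p \<le> J" "Suc J \<le> m" "I - 1 \<le> Suc J"
    using IJ by auto
  have pos1: "track [Suc p..<J] (transpose p (Suc p) i) =
      (if i = p then J else if i = Suc p then p
       else if Suc p < i \<and> i \<le> J then i - 1 else i)" for i
    unfolding track_upt[OF le(1)] transpose_def using IJ by auto
  have pos2: "track (rev [Suc J..<m]) (track [Suc p..<J] (transpose p (Suc p) i)) =
      (if i = p then J else if i = Suc p then p
       else if Suc p < i \<and> i \<le> J then i - 1
       else if J < i \<and> i < m then i + 1 else if i = m then Suc J else i)" for i
    unfolding track_rev_upt[OF le(2)] pos1 using IJ by auto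
  have end1: "transpose p (Suc p) i = Suc p \<longleftrightarrow> i = p" for i
    unfolding transpose_def using IJ by auto
  have range1: "Suc p < transpose p (Suc p) i \<and> transpose p (Suc p) i \<le> J \<longleftrightarrow> Suc p < i \<and> i \<le> J" for i
    unfolding transpose_def using IJ by auto
  have cross1: "pair_crossings [Suc p..<J] (transpose p (Suc p) i) (transpose p (Suc p) j)
      = of_bool (i = p \<and> Suc p < j \<and> j \<le> J)" if "i < j" for i j
    unfolding pair_crossings_upt[OF le(1)] end1 range1 using IJ that by (auto simp: of_bool_def)
  have end2: "track [Suc p..<J] (transpose p (Suc p) i) = m \<longleftrightarrow> i = m" for i
    unfolding pos1 using IJ by auto
  have range2: "Suc J \<le> track [Suc p..<J] (transpose p (Suc p) i) \<and>
      track [Suc p..<J] (transpose p (Suc p) i) < m \<longleftrightarrow> J < i \<and> i < m" for i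
    unfolding pos1 using IJ by auto
  have cross2: "pair_crossings (rev [Suc J..<m]) (track [Suc p..<J] (transpose p (Suc p) i))
        (track [Suc p..<J] (transpose p (Suc p) j))
      = of_bool (J < i \<and> i < m \<and> j = m)" if "i < j" for i j
    unfolding pair_crossings_rev_upt[OF le(2)] end2 range2 using IJ that by (auto simp: of_bool_def)
  have end3: "track (rev [Suc J..<m]) (track [Suc p..<J] (transpose p (Suc p) i)) = Suc J \<longleftrightarrow> i = m" for i
    unfolding pos2 using IJ by auto
  \<comment> \<open>Strands \<open>Suc p\<close> to \<open>J\<close> stand one place to the left of
    their original positions, so passing strand \<open>I\<close> means reaching
    \<open>I - 1\<close>.\<close>
  have range3: "I - 1 \<le> track (rev [Suc J..<m]) (track [Suc p..<J] (transpose p (Suc p) i)) \<and>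
      track (rev [Suc J..<m]) (track [Suc p..<J] (transpose p (Suc p) i)) < Suc J \<longleftrightarrow>
      i = p \<or> I \<le> i \<and> i \<le> J" for i
    unfolding pos2 using IJ by auto
  have cross3: "pair_crossings (rev [I - 1..<Suc J])
        (track (rev [Suc J..<m]) (track [Suc p..<J] (transpose p (Suc p) i)))
        (track (rev [Suc J..<m]) (track [Suc p..<J] (transpose p (Suc p) j)))
      = of_bool (j = m \<and> (i = p \<or> I \<le> i \<and> i \<le> J))" if "i < j" for i j
    unfolding pair_crossings_rev_upt[OF le(3)] end3 range3 using IJ that by (auto simp: of_bool_def)
  \<comment> \<open>Here \<open>I \<le> Suc J\<close> joins \<open>I \<le> i \<le> J\<close> and
    \<open>J < i < m\<close>; column \<open>Suc p\<close> of row \<open>p\<close> is left to the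
    swap.\<close>
  have total: "pair_crossings u (transpose p (Suc p) i) (transpose p (Suc p) j)
      = of_bool (i = p \<and> (Suc p < j \<and> j \<le> J \<or> j = m) \<or> j = m \<and> I \<le> i \<and> i < m)"
    if "i < j" for i j
    unfolding u_def pair_crossings_append cross1[OF that] cross2[OF that] cross3[OF that]
    using IJ that by (auto simp: of_bool_def)
  have "M = mat1 n (\<lambda>i j. if i < j then
        2 * int (pair_crossings u (transpose p (Suc p) i) (transpose p (Suc p) j))
        + (if i = p \<and> j = Suc p then 2 else 0) else 0)"
    unfolding M using IJ
    by (intro arg_cong[where f = "mat1 n"] ext) (auto simp: total)
  with \<open>set u \<subseteq> {1..<n}\<close> show ?thesis
    unfolding realizable_after_swap_def by blast
qed

section \<open>Combining two formations in one braid\<close>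

text \<open>Both matrices count the outer pair of swaps, which the common word performs only once;
  subtracting \<open>two_at\<close> corrects this.\<close>

lemma realizable_after_swap_combine:
  assumes "realizable_after_swap n p M1" and "realizable_after_swap n p M2"
    and "1 \<le> p" and "Suc p \<le> n"
  shows "CN_realizable n (M1 + M2 - two_at n p (Suc p))"
proof -
  let ?\<tau> = "transpose p (Suc p)"
  obtain u where u: "set u \<subseteq> {1..<n}"
    and M1: "M1 = mat1 n (\<lambda>i j. if i < j then 2 * int (pair_crossings u (?\<tau> i) (?\<tau> j))
           + (if i = p \<and> j = Suc p then 2 else 0) else 0)"
    using assms(1) unfolding realizable_after_swap_def by blast
  obtain v where v: "set v \<subseteq> {1..<n}"
    and M2: "M2 = mat1 n (\<lambda>i j. if i < j then 2 * int (pair_crossings v (?\<tau> i) (?\<tau> j))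
           + (if i = p \<and> j = Suc p then 2 else 0) else 0)"
    using assms(2) unfolding realizable_after_swap_def by blast
  define w where "w = [p] @ ((u @ rev u) @ v @ rev v) @ rev [p]"
  have M: "M1 + M2 - two_at n p (Suc p) = mat1 n (\<lambda>i j. if i < j then
      2 * int (pair_crossings u (?\<tau> i) (?\<tau> j)) + 2 * int (pair_crossings v (?\<tau> i) (?\<tau> j))
      + (if i = p \<and> j = Suc p then 2 else 0) else 0)"
    unfolding M1 M2 two_at_def mat1_def by (intro eq_matI) auto
  have w: "crossings id w i j =
      2 * pair_crossings u (?\<tau> i) (?\<tau> j) + 2 * pair_crossings v (?\<tau> i) (?\<tau> j)
      + (if i = p \<and> j = Suc p then 2 else 0)" if "i < j" for i j
  proof -
    have "crossings id w i j = pair_crossings w i j"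
      by (simp add: pair_crossings_def)
    also have "\<dots> = 2 * pair_crossings [p] i j
        + pair_crossings ((u @ rev u) @ v @ rev v) (track [p] i) (track [p] j)"
      unfolding w_def by (rule pair_crossings_conj) simp
    also have "\<dots> = 2 * pair_crossings [p] i j
        + (pair_crossings (u @ rev u) (?\<tau> i) (?\<tau> j) + pair_crossings (v @ rev v) (?\<tau> i) (?\<tau> j))"
      \<comment> \<open>By \<open>track_rev\<close>, \<open>u @ rev u\<close> restores all
        positions, so \<open>v\<close> also starts right after the swap.\<close>
      by (simp only: pair_crossings_append[of "u @ rev u"] track.simps track_append track_rev)
    finally show ?thesis
      using that by (auto simp: pair_crossings_palindrome doubleton_eq_iff)
  qed
  have "braid_projection n w"
    using u v assms(3,4) by (auto simp: braid_projection_def w_def)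
  moreover have "strictly_upper_triangular n (M1 + M2 - two_at n p (Suc p))"
    unfolding M strictly_upper_triangular_def by auto
  moreover have "entry (M1 + M2 - two_at n p (Suc p)) i j = entry (CN_matrix n w) i j"
    if "1 \<le> i \<and> i < j \<and> j \<le> n" for i j
    using that unfolding M CN_matrix_def by (simp add: w)
  ultimately show ?thesis
    unfolding CN_realizable_def by blast
qed

theorem proposition15:
  fixes n k l m :: nat
    and \<alpha>1 \<alpha>2 :: "nat \<Rightarrow> nat \<Rightarrow> nat \<Rightarrow> int mat \<Rightarrow> bool"
    and M1 M2 M3 :: "int mat"
  assumes "(\<alpha>1, \<alpha>2) \<in> {(c_formation, r_formation), (c_formation, rc_formation),
                        (rc_formation, r_formation), (rc_formation, rc_formation)}"
    and "1 \<le> k" and "k < l" and "l \<le> m" and "m \<le> n"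
    and "\<alpha>1 n k l M1"
    and "\<alpha>2 n (l - 1) m M2"
    and "M3 = two_at n (l - 1) l"
  shows "CN_realizable n (M1 + M2 - M3)"
proof -
  obtain p where l: "l = Suc p" and p: "1 \<le> p"
    using assms(2,3) by (cases l) auto
  have "realizable_after_swap n p M1"
    using assms(1,6) c_formation_realizable_after_swap rc_formation_realizable_after_swap_left
    unfolding l by auto
  moreover have "realizable_after_swap n p M2"
    using assms(1,7) r_formation_realizable_after_swap rc_formation_realizable_after_swap_right
    unfolding l by auto
  ultimately show ?thesis
    using realizable_after_swap_combine p assms(4,5,8) unfolding l by simp
qed

end
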